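(* Let $T$ be a tree with vertices $v_1,\dots,v_n$, fix $i\le n$, and let $T^{(i)}$ be the directed tree obtained from $T$ by directing every edge away from $v_i$. Define multipliers on the directed edges of $T^{(i)}$ recursively (from the leaves towards $v_i$) by \[ m_{pk}=d_k+1-\sum_{j:(v_k,v_j)\in\delta^+(v_k)}\frac{1}{m_{kj}} \] for each directed edge $(v_p,v_k)$ (so $m_{pk}=2$ when $v_k$ is a pendant vertex). Then for every directed edge $(v_p,v_k)$ of $T^{(i)}$, \[ 2\le \tfrac12 d_k+\tfrac32\le m_{pk}\le d_k+1, \] and if $v_k$ is a pendant vertex then equality holds throughout, so $m_{pk}=2$.
   Context: $d_k$ denotes the degree of $v_k$ in $T$; $\delta^+(v_k)$ is the set of outgoing edges $(v_k,v_s)$ of $v_k$ in $T^{(i)}$ (empty sums are $0$). A pendant vertex is a vertex of degree $1$. These multipliers satisfy $m_{pk}=x_p/x_k$, where $x$ is the $i$-th column of $(L_T+I_n)^{-1}$ and $L_T$ the Laplacian matrix of $T$. *)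

theory Defs
  imports Complex_Main "Graph_Theory.Graph_Theory"
begin

text \<open>
  A finite simple graph is a \<^locale>\<open>pair_graph\<close>, i.e. a finite, loop-free, symmetric
  digraph: an undirected edge between u and v is the pair of arcs (u,v) and (v,u), so that the
  degree of a vertex is its out-degree.

  The predicate \<^const>\<open>tree\<close> of the library excludes directed cycles, among them
  u, v, u, and so does not describe undirected trees. A cycle of a simple undirected graph has at
  least three edges.
\<close>

definition undirected_tree :: "'a pair_pre_digraph \<Rightarrow> bool" where
  "undirected_tree T \<longleftrightarrow>
     pair_graph T \<and> connected (with_proj T) \<and>
     \<not> (\<exists>c. pre_digraph.cycle (with_proj T) c \<and> 3 \<le> length c)"

definition degree :: "'a pair_pre_digraph \<Rightarrow> 'a \<Rightarrow> nat" where
  "degree T k = out_degree (with_proj T) k"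

definition pendant :: "'a pair_pre_digraph \<Rightarrow> 'a \<Rightarrow> bool" where
  "pendant T k \<longleftrightarrow> k \<in> pverts T \<and> degree T k = 1"

text \<open>
  The edge between p and k is directed away from the root r as (p,k) if the path from r to k
  ends with the step from p to k.
\<close>

definition directed_away :: "'a pair_pre_digraph \<Rightarrow> 'a \<Rightarrow> 'a pair_pre_digraph" where
  "directed_away T r =
     \<lparr> pverts = pverts T,
       parcs = {(p, k) \<in> parcs T. \<exists>q. pre_digraph.apath (with_proj T) r (q @ [(p, k)]) k} \<rparr>"

lemma parcs_directed_away:
  "(p, k) \<in> parcs (directed_away T r) \<longleftrightarrow>
     (p, k) \<in> parcs T \<and> (\<exists>q. pre_digraph.apath (with_proj T) r (q @ [(p, k)]) k)"
  by (simp add: directed_away_def)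

lemma (in pair_graph) apath_unique:
  assumes acyclic: "\<not> (\<exists>c. cycle c \<and> 3 \<le> length c)"
    and "apath u P v" "apath u Q v"
  shows "P = Q"
  using assms(2,3)
proof (induction P arbitrary: u Q)
  case Nil
  then show ?case
    by (metis apath_Nil_iff apath_nonempty_ends)
next
  case (Cons e P)
  have "Q \<noteq> []"
    using Cons.prems by (metis apath_Nil_iff apath_nonempty_ends list.distinct(1))
  then obtain f Q' where Q: "Q = f # Q'"
    by (cases Q) auto
  have e: "e \<in> parcs G" "fst e = u" "apath (snd e) P v" "u \<notin> set (awalk_verts (snd e) P)"
    using Cons.prems(1) by (auto simp: apath_Cons_iff)
  have f: "f \<in> parcs G" "fst f = u" "apath (snd f) Q' v" "u \<notin> set (awalk_verts (snd f) Q')"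
    using Cons.prems(2) unfolding Q by (auto simp: apath_Cons_iff)
  show ?case
  proof (cases "snd e = snd f")
    case True
    with e f have "e = f" by (metis prod.collapse)
    moreover have "P = Q'" using Cons.IH[of "snd e" Q'] e f True by simp
    ultimately show ?thesis using Q by simp
  next
    case False
    have w1: "awalk (snd e) P v" and w2: "awalk v (rev_path Q') (snd f)"
      using e f by (auto dest: awalkI_apath)
    then have W: "awalk (snd e) (P @ rev_path Q') (snd f)"
      by (rule awalk_appendI)
    have W_verts: "u \<notin> set (awalk_verts (snd e) (P @ rev_path Q'))"
      using set_awalk_verts_append[OF w1 w2] e f
        awalk_verts_rev_path[OF awalkI_apath[OF f(3)]] by auto
    define R where "R = awalk_to_apath (P @ rev_path Q')"
    have R: "apath (snd e) R (snd f)"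
      unfolding R_def by (rule apath_awalk_to_apath[OF W])
    have "set R \<subseteq> set (P @ rev_path Q')"
      unfolding R_def by (rule awalk_to_apath_subset[OF W])
    then have R_verts: "set (awalk_verts (snd e) R) \<subseteq> set (awalk_verts (snd e) (P @ rev_path Q'))"
      using set_awalk_verts[OF W] set_awalk_verts[OF awalkI_apath[OF R]] by auto
    have R0: "R \<noteq> []" using R False by (auto simp: apath_Nil_iff)
    have "(snd f, u) \<in> parcs G"
      using f by (metis arcs_symmetric prod.collapse)
    then have closing: "awalk (snd f) [(snd f, u)] u"
      by (auto simp: awalk_simps intro: wellformed')
    have RB: "awalk (snd e) (R @ [(snd f, u)]) u"
      using awalk_appendI[OF awalkI_apath[OF R] closing] .
    have verts: "awalk_verts (snd e) (R @ [(snd f, u)]) = awalk_verts (snd e) R @ [u]"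
      using awalk_verts_append[OF RB] by simp
    let ?c = "e # R @ [(snd f, u)]"
    have "awalk u ?c u"
      using RB e by (simp add: awalk_Cons_iff del: awalk_append_iff)
    moreover have "distinct (tl (awalk_verts u ?c))"
      using verts R R_verts W_verts by (auto simp: apath_def)
    ultimately have "cycle ?c"
      unfolding cycle_def by blast
    moreover have "3 \<le> length ?c"
      using R0 by (cases R) auto
    ultimately show ?thesis using acyclic by blast
  qed
qed

lemma (in pair_graph) apath_snoc:
  assumes "apath r P u" "(u, v) \<in> parcs G" "v \<notin> set (awalk_verts r P)"
  shows "apath r (P @ [(u, v)]) v"
proof -
  have "awalk u [(u, v)] v"
    using assms(2) by (auto simp: awalk_simps intro: wellformed')
  then have W: "awalk r (P @ [(u, v)]) v"
    using assms(1) by (blast intro: awalk_appendI awalkI_apath)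
  have "awalk_verts r (P @ [(u, v)]) = awalk_verts r P @ [v]"
    using awalk_verts_append[OF W] by simp
  then show ?thesis
    using W assms by (simp add: apath_def del: awalk_append_iff)
qed

lemma directed_away_exactly_one:
  assumes T: "undirected_tree T" and r: "r \<in> pverts T" and uv: "(u, v) \<in> parcs T"
  shows "(u, v) \<in> parcs (directed_away T r) \<longleftrightarrow> (v, u) \<notin> parcs (directed_away T r)"
proof -
  interpret pair_graph T using T by (simp add: undirected_tree_def)
  have acyclic: "\<not> (\<exists>c. cycle c \<and> 3 \<le> length c)"
    using T by (simp add: undirected_tree_def)
  have vu: "(v, u) \<in> parcs T"
    using uv by (rule arcs_symmetric)
  have verts: "u \<in> pverts T" "v \<in> pverts T"
    using uv by (auto dest: wellformed')
  have "u \<noteq> v"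
    using uv pair_no_loops by fastforce
  have "strongly_connected (with_proj T)"
    using T symmetric_connected_imp_strongly_connected[OF sym_arcs]
    by (simp add: undirected_tree_def)
  then have "r \<rightarrow>\<^sup>*\<^bsub>with_proj T\<^esub> u"
    using r verts by (auto simp: strongly_connected_def)
  then obtain P where P: "apath r P u"
    by (auto simp: reachable_apath)
  have "(u, v) \<in> parcs (directed_away T r) \<or> (v, u) \<in> parcs (directed_away T r)"
  proof (cases "v \<in> set (awalk_verts r P)")
    case False
    then have "apath r (P @ [(u, v)]) v"
      by (intro apath_snoc P uv)
    then show ?thesis using uv by (auto simp: parcs_directed_away)
  next
    case True
    then obtain P1 P2 where P12: "P = P1 @ P2" "awalk r P1 v" "awalk v P2 u"
      using awalk_decomp[OF awalkI_apath[OF P]] by blast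
    have P1: "apath r P1 v" "apath v P2 u"
      and disj: "set (awalk_verts r P1) \<inter> set (tl (awalk_verts v P2)) = {}"
      using P P12 by (auto simp: apath_append_iff)
    have "u \<in> set (tl (awalk_verts v P2))"
      using P12(3) \<open>u \<noteq> v\<close> by (cases P2) (auto simp: awalk_simps)
    then have "u \<notin> set (awalk_verts r P1)"
      using disj by blast
    then have "apath r (P1 @ [(v, u)]) u"
      by (intro apath_snoc P1(1) vu)
    then show ?thesis using vu by (auto simp: parcs_directed_away)
  qed
  moreover have False
    if uv': "(u, v) \<in> parcs (directed_away T r)" and vu': "(v, u) \<in> parcs (directed_away T r)"
  proof -
    obtain q q' where q: "apath r (q @ [(u, v)]) v" and q': "apath r (q' @ [(v, u)]) u"
      using uv' vu' by (auto simp: parcs_directed_away)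
    have "apath r q u" "apath r q' v"
      using q q' by (auto simp: apath_append_iff apath_Cons_iff)
    then have "q = q' @ [(v, u)]" "q' = q @ [(u, v)]"
      using apath_unique[OF acyclic] q q' by blast+
    then show False by simp
  qed
  ultimately show ?thesis by blast
qed

text \<open>
  The recursion terminates if T is a tree with root r and (p,k) is an arc of the directed tree;
  see \<open>multiplier_rec\<close> below. Only such arguments are of interest.
\<close>

function (domintros) multiplier :: "'a pair_pre_digraph \<Rightarrow> 'a \<Rightarrow> 'a \<times> 'a \<Rightarrow> real" where
  "multiplier T r (p, k) =
     real (degree T k) + 1
       - (\<Sum>e \<in> out_arcs (with_proj (directed_away T r)) k. 1 / multiplier T r e)"
  by pat_completeness auto

lemma multiplier_dom_arc:
  assumes T: "undirected_tree T" and arc: "(p, k) \<in> parcs (directed_away T r)"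
  shows "multiplier_dom (T, r, (p, k))"
proof -
  interpret pair_graph T using T by (simp add: undirected_tree_def)
  have acyclic: "\<not> (\<exists>c. cycle c \<and> 3 \<le> length c)"
    using T by (simp add: undirected_tree_def)
  have "multiplier_dom (T, r, (p, k))" if "apath r (q @ [(p, k)]) k" for q p k
    using that
  proof (induction "card (pverts T) - length q" arbitrary: q p k rule: less_induct)
    case less
    have "multiplier_dom (T, r, e)"
      if e_out: "e \<in> out_arcs (with_proj (directed_away T r)) k" for e
    proof -
      obtain j where e: "e = (k, j)" "(k, j) \<in> parcs (directed_away T r)"
        using e_out by (cases e) (auto simp: out_arcs_def)
      then obtain q' where q': "apath r (q' @ [(k, j)]) j"
        by (auto simp: parcs_directed_away)
      then have "apath r q' k"
        by (auto simp: apath_append_iff apath_Cons_iff)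
      then have "q' = q @ [(p, k)]"
        using apath_unique[OF acyclic _ less.prems] by blast
      moreover have "length (q' @ [(k, j)]) < card (pverts T)"
        using length_apath_less[OF q'] by simp
      ultimately show ?thesis
        using less.hyps[OF _ q'] e(1) by simp
    qed
    then show ?case
      by - (rule multiplier.domintros, simp add: out_arcs_def)
  qed
  then show ?thesis
    using arc by (auto simp: parcs_directed_away)
qed

lemma multiplier_rec:
  assumes "undirected_tree T" "(p, k) \<in> parcs (directed_away T r)"
  shows "multiplier T r (p, k) =
     real (degree T k) + 1
       - (\<Sum>e \<in> out_arcs (with_proj (directed_away T r)) k. 1 / multiplier T r e)"
  using multiplier.psimps[OF multiplier_dom_arc[OF assms]] .

end

theory Submission
  imports Defs
begin

text \<open>
  Apart from the arc back to \<open>p\<close>, at most \<open>d\<^sub>k - 1\<close> arcs leave \<open>k\<close>. If each of them has multiplier at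
  least \<open>2\<close>, then the sum of the reciprocals lies between \<open>0\<close> and \<open>(d\<^sub>k - 1) / 2\<close>, so
  \<open>m\<^sub>p\<^sub>k \<ge> d\<^sub>k + 1 - (d\<^sub>k - 1) / 2 = d\<^sub>k / 2 + 3 / 2 \<ge> 2\<close>, and the bound \<open>2\<close> propagates from the
  leaves to the root.
\<close>

text \<open>The reversed arc \<open>(k, p)\<close> leaves \<open>k\<close> in \<open>T\<close> but
  not in \<open>directed_away T r\<close>, which keeps exactly one direction of each edge; so the
  inclusion of out-arcs is strict.\<close>

lemma card_out_arcs_directed_away:
  assumes T: "undirected_tree T" and r: "r \<in> pverts T"
    and pk: "(p, k) \<in> parcs (directed_away T r)"
  shows "card (out_arcs (with_proj (directed_away T r)) k) < degree T k"
proof -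
  interpret pair_graph T using T by (simp add: undirected_tree_def)
  let ?A = "out_arcs (with_proj (directed_away T r)) k"
  let ?B = "out_arcs (with_proj T) k"
  have pk': "(p, k) \<in> parcs T"
    using pk by (simp add: parcs_directed_away)
  have kp: "(k, p) \<in> ?B"
    using arcs_symmetric[OF pk'] by simp
  have "(k, p) \<notin> ?A"
    using directed_away_exactly_one[OF T r pk'] pk by simp
  moreover have "?A \<subseteq> ?B"
    by (auto simp: directed_away_def)
  ultimately have psub: "?A \<subset> ?B"
    using kp by blast
  have "finite ?B"
    using finite_arcs by (rule finite_subset[rotated]) auto
  then show ?thesis
    using psubset_card_mono[OF _ psub] by (simp add: degree_def out_degree_def)
qed

lemma multiplier_bounds:
  assumes T: "undirected_tree T" and r: "r \<in> pverts T"
    and arc: "(p, k) \<in> parcs (directed_away T r)"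
  shows "real (degree T k) / 2 + 3 / 2 \<le> multiplier T r (p, k)"
    and "multiplier T r (p, k) \<le> real (degree T k) + 1"
proof -
  \<comment> \<open>\<open>multiplier.pinduct\<close> varies all arguments of
    \<open>multiplier\<close>, so the claim is stated for an arbitrary arc \<open>e\<close> with
    head \<open>snd e\<close>.\<close>
  have "real (degree T (snd e)) / 2 + 3 / 2 \<le> multiplier T r e \<and>
      multiplier T r e \<le> real (degree T (snd e)) + 1"
    if "multiplier_dom (T, r, e)" "undirected_tree T" "r \<in> pverts T"
      "e \<in> parcs (directed_away T r)" for T :: "'a pair_pre_digraph" and r e
    using that
  proof (induction rule: multiplier.pinduct)
    case (1 T r p k)
    let ?A = "out_arcs (with_proj (directed_away T r)) k"
    let ?S = "\<Sum>e\<in>?A. 1 / multiplier T r e"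
    have card: "card ?A < degree T k"
      using 1 by (intro card_out_arcs_directed_away)
    have two: "2 \<le> multiplier T r e" if e: "e \<in> ?A" for e
    proof -
      obtain j where j: "e = (k, j)" and kj: "(k, j) \<in> parcs (directed_away T r)"
        using e by (cases e) auto
      \<comment> \<open>The strict cardinality bound excludes degree 0 at the head \<open>j\<close>,
        and 1/2 + 3/2 = 2.\<close>
      have "1 \<le> degree T j"
        using card_out_arcs_directed_away[OF "1.prems"(1,2) kj] by simp
      moreover have "real (degree T j) / 2 + 3 / 2 \<le> multiplier T r e"
        using "1.IH"[OF e "1.prems"(1,2)] kj j by simp
      ultimately show ?thesis by simp
    qed
    \<comment> \<open>Nonnegativity of \<open>?S\<close> gives the upper bound on the multiplier;
      the estimate by halves gives the lower one.\<close>
    have "0 \<le> ?S"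
      using two by (intro sum_nonneg) fastforce
    moreover have "?S \<le> real (card ?A) * (1 / 2)"
    proof (rule sum_bounded_above)
      show "1 / multiplier T r e \<le> 1 / 2" if "e \<in> ?A" for e
        using two[OF that] by (intro frac_le) auto
    qed
    ultimately show ?case
      using card multiplier_rec[OF "1.prems"(1,3)] by simp
  qed
  from this[OF multiplier_dom_arc[OF T arc] T r arc]
  show "real (degree T k) / 2 + 3 / 2 \<le> multiplier T r (p, k)"
    and "multiplier T r (p, k) \<le> real (degree T k) + 1"
    by simp_all
qed

theorem theorem4p6:
  fixes T :: "'a pair_pre_digraph" and r p k :: 'a
  assumes "undirected_tree T"
    and "r \<in> pverts T"
    and "(p, k) \<in> parcs (directed_away T r)"
  shows "2 \<le> 1 / 2 * real (degree T k) + 3 / 2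
       \<and> 1 / 2 * real (degree T k) + 3 / 2 \<le> multiplier T r (p, k)
       \<and> multiplier T r (p, k) \<le> real (degree T k) + 1
       \<and> (pendant T k \<longrightarrow>
            2 = 1 / 2 * real (degree T k) + 3 / 2
          \<and> 1 / 2 * real (degree T k) + 3 / 2 = multiplier T r (p, k)
          \<and> multiplier T r (p, k) = real (degree T k) + 1
          \<and> multiplier T r (p, k) = 2)"
  \<comment> \<open>The cardinality bound makes the degree of \<open>k\<close> positive, hence the
    first inequality. At degree 1 both bounds on the multiplier equal 2.\<close>
  using multiplier_bounds[OF assms] card_out_arcs_directed_away[OF assms]
  by (auto simp: pendant_def)

end
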